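(* Let $\mathcal Q$ be a logic on a Hilbert space $\mathcal H$. For any $u,v\in\mathbf R^{(\mathcal Q)}$, $$\underline{\mathrm{Or}}(u,v)=\mathcal P\{\psi\in\mathcal H:[u(\check x),v(\check y)]\psi=0\text{ for all }x,y\in\mathbf Q\}.$$
   Context: $\mathcal Q(\mathcal H)$ is the lattice of orthogonal projections on $\mathcal H$ (order by inclusion of ranges, $\wedge,\vee$ and arbitrary $\bigwedge,\bigvee$ via intersection / closed span of union of ranges, $P^\perp=1-P$). $\mathcal P S$ is the projection onto a closed subspace $S$; $[X,Y]=XY-YX$. $\mathcal A^!=\{P\in\mathcal Q(\mathcal H):PQ=QP\ \forall Q\in\mathcal A\}$; a logic is $\mathcal Q\subseteq\mathcal Q(\mathcal H)$ with $\mathcal Q=\mathcal Q^{!!}$. $P\Rightarrow Q=P^\perp\vee(P\wedge Q)$, $P\Leftrightarrow Q=(P\Rightarrow Q)\wedge(Q\Rightarrow P)$. $\mathrm{cdom}(\mathcal A)=\bigvee\{E\in\mathcal A^!:(P_1\wedge E)(P_2\wedge E)=(P_2\wedge E)(P_1\wedge E)\ \forall P_1,P_2\in\mathcal A\}$. $V^{(\mathcal Q)}=\bigcup_\alpha V^{(\mathcal Q)}_\alpha$, $V^{(\mathcal Q)}_\alpha$ the set of functions $u$ with values in $\mathcal Q$ and $\mathrm{dom}(u)\subseteq\bigcup_{\beta<\alpha}V^{(\mathcal Q)}_\beta$. Support $L(u)=\bigcup_{x\in\mathrm{dom}(u)}L(x)\cup\{u(x):x\in\mathrm{dom}(u)\}$;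 $\underline{\mathrm{Or}}(u,v)=\mathrm{cdom}(L(u)\cup L(v))$. Truth values: $[\![u=v]\!]=\bigwedge_{u'\in\mathrm{dom}(u)}(u(u')\Rightarrow[\![u'\in v]\!])\wedge\bigwedge_{v'\in\mathrm{dom}(v)}(v(v')\Rightarrow[\![v'\in u]\!])$, $[\![u\in v]\!]=\bigvee_{v'\in\mathrm{dom}(v)}(v(v')\wedge[\![u=v']\!])$, $[\![\neg\phi]\!]=[\![\phi]\!]^\perp$, connectives by lattice operations, $[\![(\forall x\in u)\phi]\!]=\bigwedge_{u'\in\mathrm{dom}(u)}(u(u')\Rightarrow[\![\phi(u')]\!])$, $[\![(\exists x\in u)\phi]\!]=\bigvee_{u'\in\mathrm{dom}(u)}(u(u')\wedge[\![\phi(u')]\!])$. For a set $v$, $\check v=\{(\check w,1):w\in v\}$; $\mathbf Q$ is the rationals. $\mathbf R(x)$ is $x\subseteq\check{\mathbf Q}\wedge\exists y\in\check{\mathbf Q}(y\in x)\wedge\exists y\in\check{\mathbf Q}(y\notin x)\wedge\forall y\in\check{\mathbf Q}(y\in x\Leftrightarrow\forall z\in\check{\mathbf Q}(y<z\Rightarrow z\in x))$ ($x\subseteq y$ abbreviates $\forall z\in x(z\in y)$, $<$ the order of rationals); $\mathbf R^{(\mathcal Q)}=\{u\in V^{(\mathcal Q)}:\mathrm{dom}(u)=\{\check r:r\in\mathbf Q\},\ [\![\mathbf R(u)]\!]=1\}$. *)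

theory Defs
  imports "HOL-Analysis.Analysis" "HOL-Library.Infinite_Typeclass" "HOL-Library.Multiset"
begin

section \<open>Complex Hilbert spaces\<close>

text \<open>
  The class extends the library's complete real inner product spaces by a complex structure.  The
  inner product is linear in its second argument, and its real part is the underlying real inner
  product; so norm and topology are the usual ones.
\<close>

class complex_hilbert_space = real_inner + complete_space +
  fixes scaleC :: "complex \<Rightarrow> 'a \<Rightarrow> 'a" (infixr "*\<^sub>C" 75)
    and cinner :: "'a \<Rightarrow> 'a \<Rightarrow> complex"
  assumes scaleC_add_right: "c *\<^sub>C (x + y) = c *\<^sub>C x + c *\<^sub>C y"
    and scaleC_add_left: "(c + d) *\<^sub>C x = c *\<^sub>C x + d *\<^sub>C x"
    and scaleC_scaleC: "c *\<^sub>C d *\<^sub>C x = (c * d) *\<^sub>C x"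
    and scaleC_of_real: "complex_of_real r *\<^sub>C x = r *\<^sub>R x"
    and cinner_commute: "cinner x y = cnj (cinner y x)"
    and cinner_add_right: "cinner x (y + z) = cinner x y + cinner x z"
    and cinner_scaleC_right: "cinner x (c *\<^sub>C y) = c * cinner x y"
    and Re_cinner: "Re (cinner x y) = inner x y"

interpretation complex_vector:
  vector_space "scaleC :: complex \<Rightarrow> 'h \<Rightarrow> 'h::complex_hilbert_space"
proof unfold_locales
  show "1 *\<^sub>C x = x" for x :: 'h
    using scaleC_of_real[of 1 x] by simp
qed (simp_all add: scaleC_add_right scaleC_add_left scaleC_scaleC)

instantiation complex :: complex_hilbert_space
begin

definition "scaleC_complex = (\<lambda>c x :: complex. c * x)"

definition "cinner_complex = (\<lambda>x y :: complex. cnj x * y)"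

instance
  by standard (auto simp: scaleC_complex_def cinner_complex_def algebra_simps
    scaleR_conv_of_real inner_complex_def)

end

section \<open>The lattice of projections\<close>

definition projections :: "('h::complex_hilbert_space \<Rightarrow> 'h) set" where
  "projections = {P. bounded_linear P \<and> (\<forall>c x. P (c *\<^sub>C x) = c *\<^sub>C P x) \<and>
     P \<circ> P = P \<and> (\<forall>x y. cinner (P x) y = cinner x (P y))}"

text \<open>Only meaningful if \<open>S\<close> is a closed complex subspace.\<close>

definition proj_onto :: "'h::complex_hilbert_space set \<Rightarrow> ('h \<Rightarrow> 'h)" where
  "proj_onto S = (THE P. P \<in> projections \<and> range P = S)"

definition perp :: "('h::complex_hilbert_space \<Rightarrow> 'h) \<Rightarrow> ('h \<Rightarrow> 'h)" where
  "perp P = (\<lambda>x. x - P x)"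

definition Meet :: "('h::complex_hilbert_space \<Rightarrow> 'h) set \<Rightarrow> ('h \<Rightarrow> 'h)" where
  "Meet A = proj_onto (\<Inter>P\<in>A. range P)"

definition Join :: "('h::complex_hilbert_space \<Rightarrow> 'h) set \<Rightarrow> ('h \<Rightarrow> 'h)" where
  "Join A = proj_onto (closure (complex_vector.span (\<Union>P\<in>A. range P)))"

definition meet :: "('h::complex_hilbert_space \<Rightarrow> 'h) \<Rightarrow> ('h \<Rightarrow> 'h) \<Rightarrow> ('h \<Rightarrow> 'h)"
    (infixr "\<^bold>\<and>" 65) where
  "P \<^bold>\<and> Q = Meet {P, Q}"

definition join :: "('h::complex_hilbert_space \<Rightarrow> 'h) \<Rightarrow> ('h \<Rightarrow> 'h) \<Rightarrow> ('h \<Rightarrow> 'h)"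
    (infixr "\<^bold>\<or>" 60) where
  "P \<^bold>\<or> Q = Join {P, Q}"

definition sasaki_imp :: "('h::complex_hilbert_space \<Rightarrow> 'h) \<Rightarrow> ('h \<Rightarrow> 'h) \<Rightarrow> ('h \<Rightarrow> 'h)"
    (infixr "\<^bold>\<Rightarrow>" 55) where
  "(P \<^bold>\<Rightarrow> Q) = perp P \<^bold>\<or> (P \<^bold>\<and> Q)"

definition sasaki_iff :: "('h::complex_hilbert_space \<Rightarrow> 'h) \<Rightarrow> ('h \<Rightarrow> 'h) \<Rightarrow> ('h \<Rightarrow> 'h)"
    (infixr "\<^bold>\<Leftrightarrow>" 55) where
  "(P \<^bold>\<Leftrightarrow> Q) = (P \<^bold>\<Rightarrow> Q) \<^bold>\<and> (Q \<^bold>\<Rightarrow> P)"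

definition commutator :: "('h::complex_hilbert_space \<Rightarrow> 'h) \<Rightarrow> ('h \<Rightarrow> 'h) \<Rightarrow> ('h \<Rightarrow> 'h)" where
  "commutator X Y = (\<lambda>\<psi>. X (Y \<psi>) - Y (X \<psi>))"

definition commutant :: "('h::complex_hilbert_space \<Rightarrow> 'h) set \<Rightarrow> ('h \<Rightarrow> 'h) set" where
  "commutant A = {P \<in> projections. \<forall>Q\<in>A. P \<circ> Q = Q \<circ> P}"

definition is_logic :: "('h::complex_hilbert_space \<Rightarrow> 'h) set \<Rightarrow> bool" where
  "is_logic \<Q> \<longleftrightarrow> \<Q> \<subseteq> projections \<and> \<Q> = commutant (commutant \<Q>)"

definition cdom :: "('h::complex_hilbert_space \<Rightarrow> 'h) set \<Rightarrow> ('h \<Rightarrow> 'h)" where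
  "cdom A = Join {E \<in> commutant A. \<forall>P\<^sub>1\<in>A. \<forall>P\<^sub>2\<in>A.
     (P\<^sub>1 \<^bold>\<and> E) \<circ> (P\<^sub>2 \<^bold>\<and> E) = (P\<^sub>2 \<^bold>\<and> E) \<circ> (P\<^sub>1 \<^bold>\<and> E)}"

section \<open>Names\<close>

text \<open>
  \<open>('k, 'p) name\<close> is the type of well-founded extensional objects \<open>u\<close> that are determined by a set
  \<open>graph u\<close> of pairs of a name and a label in \<open>'p\<close>, where \<open>graph u\<close> ranges over precisely the sets
  of at most \<open>|'k|\<close> such pairs (\<open>graph_inject\<close>, \<open>ex_name\<close>, \<open>wf_member_rel\<close> below).  HOL has no type
  of all sets, so sizes are bounded by a type \<open>'k\<close>, which is left arbitrary: it is a parameter of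
  every statement about names.  The type is the quotient of \<open>'k\<close>-branching trees by extensional
  equality.
\<close>

datatype ('k, 'p) tree = Tree "'k \<Rightarrow> (('k, 'p) tree \<times> 'p) option"

inductive ext_eq :: "('k, 'p) tree \<Rightarrow> ('k, 'p) tree \<Rightarrow> bool" where
  "\<lbrakk>\<And>i s p. f i = Some (s, p) \<Longrightarrow> \<exists>j t. g j = Some (t, p) \<and> ext_eq s t;
    \<And>j t p. g j = Some (t, p) \<Longrightarrow> \<exists>i s. f i = Some (s, p) \<and> ext_eq s t\<rbrakk>
   \<Longrightarrow> ext_eq (Tree f) (Tree g)"

lemma ext_eq_Tree:
  "ext_eq (Tree f) (Tree g) \<longleftrightarrow>
    (\<forall>i s p. f i = Some (s, p) \<longrightarrow> (\<exists>j t. g j = Some (t, p) \<and> ext_eq s t)) \<and>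
    (\<forall>j t p. g j = Some (t, p) \<longrightarrow> (\<exists>i s. f i = Some (s, p) \<and> ext_eq s t))"
  by (subst ext_eq.simps) blast

lemma tree_induct [case_names Tree]:
  assumes "\<And>f. (\<And>i t p. f i = Some (t, p) \<Longrightarrow> P t) \<Longrightarrow> P (Tree f)"
  shows "P t"
proof (induction t)
  case (Tree f)
  show ?case
  proof (rule assms)
    fix i t p assume "f i = Some (t, p)"
    moreover have "f i \<in> range f" by simp
    moreover have "t \<in> Basic_BNFs.fsts (t, p)" by (simp add: fsts.simps)
    ultimately show "P t"
      using Tree[of "f i" "(t, p)" t] by simp
  qed
qed

lemma ext_eq_refl: "ext_eq t t"
  by (induction t rule: tree_induct) (unfold ext_eq_Tree, blast)

lemma ext_eq_sym: "ext_eq s t \<Longrightarrow> ext_eq t s"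
proof (induction s t rule: ext_eq.induct)
  case (1 f g)
  then show ?case unfolding ext_eq_Tree by meson
qed

lemma ext_eq_trans: "ext_eq s t \<Longrightarrow> ext_eq t r \<Longrightarrow> ext_eq s r"
proof (induction s t arbitrary: r rule: ext_eq.induct)
  case (1 f g)
  obtain h where r: "r = Tree h" by (cases r)
  show ?case
    using 1 unfolding r ext_eq_Tree by (meson)
qed

quotient_type ('k, 'p) name = "('k, 'p) tree" / ext_eq
  by (rule equivpI) (auto intro!: reflpI sympI transpI intro: ext_eq_refl ext_eq_sym ext_eq_trans)

definition graph :: "('k, 'p) name \<Rightarrow> (('k, 'p) name \<times> 'p) set" where
  "graph u = {(abs_name t, p) | f i t p. abs_name (Tree f) = u \<and> f i = Some (t, p)}"

definition Name :: "(('k, 'p) name \<times> 'p) set \<Rightarrow> ('k, 'p) name" where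
  "Name G = (THE u. graph u = G)"

definition dom_name :: "('k, 'p) name \<Rightarrow> ('k, 'p) name set" where
  "dom_name u = fst ` graph u"

definition val :: "('k, 'p) name \<Rightarrow> ('k, 'p) name \<Rightarrow> 'p" where
  "val u x = (THE p. (x, p) \<in> graph u)"

definition member_rel :: "(('k, 'p) name \<times> ('k, 'p) name) set" where
  "member_rel = {(x, u). x \<in> dom_name u}"

lemma abs_name_eq_iff: "abs_name s = abs_name t \<longleftrightarrow> ext_eq s t"
  by (rule name.abs_eq_iff)

lemma graph_Tree: "graph (abs_name (Tree f)) = {(abs_name t, p) | i t p. f i = Some (t, p)}"
  (is "?L = ?R")
proof
  show "?R \<subseteq> ?L" unfolding graph_def by blast
  show "?L \<subseteq> ?R"
  proof
    fix z assume "z \<in> ?L"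
    then obtain g i t p where z: "z = (abs_name t, p)" and "ext_eq (Tree g) (Tree f)"
      and "g i = Some (t, p)"
      unfolding graph_def abs_name_eq_iff by blast
    then obtain j t' where "f j = Some (t', p)" "ext_eq t t'"
      unfolding ext_eq_Tree by blast
    then show "z \<in> ?R" unfolding z using abs_name_eq_iff by blast
  qed
qed

lemma name_exhaust: obtains f where "u = abs_name (Tree f)"
proof -
  obtain t where "u = abs_name t" by (metis Quotient3_abs_rep Quotient3_name)
  then show ?thesis using that by (cases t) auto
qed

lemma graph_inject: "graph u = graph v \<longleftrightarrow> u = v"
proof
  assume eq: "graph u = graph v"
  obtain f g where u: "u = abs_name (Tree f)" and v: "v = abs_name (Tree g)"
    by (metis name_exhaust)
  have sub: "\<exists>j t. g j = Some (t, p) \<and> ext_eq s t"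
    if "{(abs_name t, p) | i t p. f i = Some (t, p)} \<subseteq> {(abs_name t, p) | i t p. g i = Some (t, p)}"
      and "f i = Some (s, p)" for f g :: "'a \<Rightarrow> (('a, 'b) tree \<times> 'b) option" and i s p
  proof -
    have "(abs_name s, p) \<in> {(abs_name t, p) | i t p. g i = Some (t, p)}"
      using that by blast
    then show ?thesis by (auto simp: abs_name_eq_iff)
  qed
  have "ext_eq (Tree f) (Tree g)"
    unfolding ext_eq_Tree
    using eq sub[of f g] sub[of g f] ext_eq_sym unfolding u v graph_Tree by (metis (no_types, lifting) order_refl)
  then show "u = v" unfolding u v abs_name_eq_iff .
qed simp

lemma name_induct [case_names name]:
  assumes "\<And>u. (\<And>x. x \<in> dom_name u \<Longrightarrow> P x) \<Longrightarrow> P u"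
  shows "P u"
proof -
  have "P (abs_name t)" for t
  proof (induction t rule: tree_induct)
    case (Tree f)
    show ?case by (rule assms) (use Tree in \<open>auto simp: dom_name_def graph_Tree\<close>)
  qed
  then show ?thesis by (metis name_exhaust)
qed

lemma wf_member_rel: "wf member_rel"
  by (rule wfUNIVI, rule name_induct) (auto simp: member_rel_def)

lemma ex_name:
  fixes G :: "(('k, 'p) name \<times> 'p) set"
  shows "(\<exists>u. graph u = G) \<longleftrightarrow> G \<lesssim> (UNIV :: 'k set)"
proof
  assume "\<exists>u. graph u = G"
  then obtain f :: "'k \<Rightarrow> (('k, 'p) tree \<times> 'p) option"
    where G: "G = {(abs_name t, p) | i t p. f i = Some (t, p)}"
    by (metis name_exhaust graph_Tree)
  have "G \<subseteq> (\<lambda>i. map_prod abs_name id (the (f i))) ` UNIV"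
  proof
    fix z assume "z \<in> G"
    then obtain i t p where "z = (abs_name t, p)" "f i = Some (t, p)" unfolding G by blast
    then have "z = map_prod abs_name id (the (f i))" by simp
    then show "z \<in> (\<lambda>i. map_prod abs_name id (the (f i))) ` UNIV" by blast
  qed
  then show "G \<lesssim> (UNIV :: 'k set)"
    by (meson image_lepoll lepoll_trans subset_imp_lepoll)
next
  assume "G \<lesssim> (UNIV :: 'k set)"
  then obtain e :: "('k, 'p) name \<times> 'p \<Rightarrow> 'k" where e: "inj_on e G"
    unfolding lepoll_def by blast
  define f where "f i = (if i \<in> e ` G
    then Some (rep_name (fst (inv_into G e i)), snd (inv_into G e i)) else None)" for i
  have "graph (abs_name (Tree f)) = G"
  proof (rule set_eqI)
    fix z :: "('k, 'p) name \<times> 'p"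
    have ar: "abs_name (rep_name x) = x" for x :: "('k, 'p) name"
      by (rule Quotient3_abs_rep[OF Quotient3_name])
    have "z \<in> graph (abs_name (Tree f)) \<longleftrightarrow> (\<exists>i\<in>e ` G. z = inv_into G e i)"
      unfolding graph_Tree f_def by (auto simp: ar split: if_splits; metis)
    also have "\<dots> \<longleftrightarrow> z \<in> G" using e by auto
    finally show "z \<in> graph (abs_name (Tree f)) \<longleftrightarrow> z \<in> G" .
  qed
  then show "\<exists>u. graph u = G" by blast
qed

lemma graph_Name:
  "G \<lesssim> (UNIV :: 'k set) \<Longrightarrow> graph (Name G :: ('k, 'p) name) = G"
  unfolding Name_def using ex_name[of G] graph_inject by (metis (mono_tags, lifting) theI)

text \<open>The least fixed point below is the union of the cumulative hierarchy.\<close>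

inductive_set universe :: "'p set \<Rightarrow> ('k, 'p) name set" for \<Q> :: "'p set" where
  "\<lbrakk>single_valued (graph u); \<And>x. x \<in> dom_name u \<Longrightarrow> x \<in> universe \<Q>;
    val u ` dom_name u \<subseteq> \<Q>\<rbrakk> \<Longrightarrow> u \<in> universe \<Q>"

section \<open>Support and truth values\<close>

declare image_cong [fundef_cong]

function support :: "('k, 'p) name \<Rightarrow> 'p set" where
  "support u = (\<Union>x\<in>dom_name u. support x) \<union> val u ` dom_name u"
  by auto
termination
  by (relation member_rel) (auto simp: wf_member_rel, simp add: member_rel_def)

definition Or :: "('k, 'h::complex_hilbert_space \<Rightarrow> 'h) name \<Rightarrow> ('k, 'h \<Rightarrow> 'h) name \<Rightarrow> ('h \<Rightarrow> 'h)"
  where "Or u v = cdom (support u \<union> support v)"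

function (sequential)
  eq_val :: "('k, 'h::complex_hilbert_space \<Rightarrow> 'h) name \<Rightarrow> ('k, 'h \<Rightarrow> 'h) name \<Rightarrow> ('h \<Rightarrow> 'h)" and
  mem_val :: "('k, 'h \<Rightarrow> 'h) name \<Rightarrow> ('k, 'h \<Rightarrow> 'h) name \<Rightarrow> ('h \<Rightarrow> 'h)"
where
  "eq_val u v =
    Meet ((\<lambda>u'. val u u' \<^bold>\<Rightarrow> mem_val u' v) ` dom_name u) \<^bold>\<and>
    Meet ((\<lambda>v'. val v v' \<^bold>\<Rightarrow> mem_val v' u) ` dom_name v)"
| "mem_val u v = Join ((\<lambda>v'. val v v' \<^bold>\<and> eq_val u v') ` dom_name v)"
  by pat_completeness auto
termination
proof (relation "inv_image (mult member_rel) (case_sum (\<lambda>(u, v). {#u, v#}) (\<lambda>(u, v). {#u, v#}))")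
  show "wf (inv_image (mult member_rel) (case_sum (\<lambda>(u, v). {#u, v#}) (\<lambda>(u, v). {#u, v#})))"
    by (intro wf_inv_image wf_mult wf_member_rel)
  have *: "({#x, v#}, {#u, v#}) \<in> mult member_rel" "({#v, x#}, {#v, u#}) \<in> mult member_rel"
    if "x \<in> dom_name u" for x u v :: "('a, 'b \<Rightarrow> 'b) name"
    using that one_step_implies_mult[of "{#u#}" "{#x#}" member_rel "{#v#}"]
    by (auto simp: member_rel_def add_mset_commute)
  show "(Inr (u', v), Inl (u, v)) \<in> inv_image (mult member_rel)
      (case_sum (\<lambda>(u, v). {#u, v#}) (\<lambda>(u, v). {#u, v#}))"
    if "u' \<in> dom_name u" for u u' v :: "('a, 'b \<Rightarrow> 'b) name"
    using *[OF that] by simp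
  show "(Inr (v', u), Inl (u, v)) \<in> inv_image (mult member_rel)
      (case_sum (\<lambda>(u, v). {#u, v#}) (\<lambda>(u, v). {#u, v#}))"
    if "v' \<in> dom_name v" for u v v' :: "('a, 'b \<Rightarrow> 'b) name"
    using *[OF that] by (simp add: add_mset_commute)
  show "(Inl (u, v'), Inr (u, v)) \<in> inv_image (mult member_rel)
      (case_sum (\<lambda>(u, v). {#u, v#}) (\<lambda>(u, v). {#u, v#}))"
    if "v' \<in> dom_name v" for u v v' :: "('a, 'b \<Rightarrow> 'b) name"
    using *[OF that] by simp
qed

declare support.simps [simp del] eq_val.simps [simp del] mem_val.simps [simp del]

definition ball_val :: "('k, 'h::complex_hilbert_space \<Rightarrow> 'h) name \<Rightarrow>
    (('k, 'h \<Rightarrow> 'h) name \<Rightarrow> ('h \<Rightarrow> 'h)) \<Rightarrow> ('h \<Rightarrow> 'h)" where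
  "ball_val u \<phi> = Meet ((\<lambda>u'. val u u' \<^bold>\<Rightarrow> \<phi> u') ` dom_name u)"

definition bex_val :: "('k, 'h::complex_hilbert_space \<Rightarrow> 'h) name \<Rightarrow>
    (('k, 'h \<Rightarrow> 'h) name \<Rightarrow> ('h \<Rightarrow> 'h)) \<Rightarrow> ('h \<Rightarrow> 'h)" where
  "bex_val u \<phi> = Join ((\<lambda>u'. val u u' \<^bold>\<and> \<phi> u') ` dom_name u)"

section \<open>Ground model sets and the reals\<close>

text \<open>A set is represented as a name all of whose labels are trivial.\<close>

type_synonym 'k pure_set = "('k, unit) name"

text \<open>The identity operator is the unit of the projection lattice.\<close>

function check :: "'k pure_set \<Rightarrow> ('k, 'h::complex_hilbert_space \<Rightarrow> 'h) name" where
  "check v = Name ((\<lambda>w. (check w, id)) ` dom_name v)"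
  by auto
termination
  by (relation member_rel) (auto simp: wf_member_rel, simp add: member_rel_def)

declare check.simps [simp del]

lemma graph_check: "graph (check v) = (\<lambda>w. (check w, id)) ` dom_name v"
proof -
  have "dom_name v \<lesssim> (UNIV :: 'a set)"
    unfolding dom_name_def by (meson image_lepoll lepoll_trans ex_name)
  then show ?thesis
    by (subst check.simps) (meson graph_Name image_lepoll lepoll_trans)
qed

text \<open>
  In the following, \<open>q\<close> is the map that assigns to each rational number the set by which it is
  represented, in whichever set-theoretic construction of the rationals.  The cardinality
  class on \<open>'k\<close> ensures that the rationals form a set.
\<close>

definition check_rats :: "(rat \<Rightarrow> 'k::infinite pure_set) \<Rightarrow>
    ('k, 'h::complex_hilbert_space \<Rightarrow> 'h) name" where
  "check_rats q = check (Name (range (\<lambda>r. (q r, ()))))"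

lemma graph_check_rats: "graph (check_rats q) = range (\<lambda>r. (check (q r), id))"
proof -
  have "range (\<lambda>r. (q r, ())) \<lesssim> (UNIV :: 'a set)"
  proof (rule lepoll_trans)
    have "range (\<lambda>r. (q r, ())) \<lesssim> (UNIV :: rat set)" by (rule image_lepoll)
    also have "(UNIV :: rat set) \<lesssim> (UNIV :: nat set)"
      unfolding lepoll_def by (rule exI[of _ to_nat]) simp
    finally show "range (\<lambda>r. (q r, ())) \<lesssim> (UNIV :: nat set)" .
    show "(UNIV :: nat set) \<lesssim> (UNIV :: 'a set)"
      using infinite_UNIV infinite_le_lepoll by blast
  qed
  then have "dom_name (Name (range (\<lambda>r. (q r, ())))) = range q"
    unfolding dom_name_def by (simp add: graph_Name image_image)
  then show ?thesis
    unfolding check_rats_def graph_check by (simp add: image_image)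
qed

text \<open>
  The order of the rationals as a relation on names, that is,
  membership of the pair in the check of \<open>{(r, s). r < s}\<close>.
\<close>

definition less_val :: "(rat \<Rightarrow> 'k::infinite pure_set) \<Rightarrow>
    ('k, 'h::complex_hilbert_space \<Rightarrow> 'h) name \<Rightarrow> ('k, 'h \<Rightarrow> 'h) name \<Rightarrow> ('h \<Rightarrow> 'h)" where
  "less_val q y z = Join {eq_val y (check (q r)) \<^bold>\<and> eq_val z (check (q s)) | r s. r < s}"

definition real_val :: "(rat \<Rightarrow> 'k::infinite pure_set) \<Rightarrow>
    ('k, 'h::complex_hilbert_space \<Rightarrow> 'h) name \<Rightarrow> ('h \<Rightarrow> 'h)" where
  "real_val q x =
    ball_val x (\<lambda>z. mem_val z (check_rats q)) \<^bold>\<and>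
    bex_val (check_rats q) (\<lambda>y. mem_val y x) \<^bold>\<and>
    bex_val (check_rats q) (\<lambda>y. perp (mem_val y x)) \<^bold>\<and>
    ball_val (check_rats q) (\<lambda>y. mem_val y x \<^bold>\<Leftrightarrow>
      ball_val (check_rats q) (\<lambda>z. less_val q y z \<^bold>\<Rightarrow> mem_val z x))"

definition reals :: "(rat \<Rightarrow> 'k::infinite pure_set) \<Rightarrow> ('h::complex_hilbert_space \<Rightarrow> 'h) set \<Rightarrow>
    ('k, 'h \<Rightarrow> 'h) name set" where
  "reals q \<Q> = {u \<in> universe \<Q>. dom_name u = range (\<lambda>r. check (q r)) \<and> real_val q u = id}"

end

theory Submission
  imports Defs
begin

text \<open>
  On check names all truth values are trivial, so the value of \<open>R(u)\<close> being \<open>1\<close> says that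
  \<open>u(r) = \<Sqinter>\<^bsub>s > r\<^esub> u(s)\<close>.  In particular \<open>r \<mapsto> u(r)\<close> is increasing, and the product of two values
  of \<open>u\<close> is again a value of \<open>u\<close>.  This makes the common kernel \<open>S\<close> of the commutators
  \<open>[u(x), v(y)]\<close> invariant: for \<open>\<psi> \<in> S\<close>,
  \<open>u(x') v(y) u(x) \<psi> = u(x') u(x) v(y) \<psi> = u(z) v(y) \<psi> = v(y) u(z) \<psi> = v(y) u(x') u(x) \<psi>\<close> where
  \<open>z = min x x'\<close>.  Hence the projection onto \<open>S\<close> lies in the commutant of the support, and it is
  the largest projection admitted in the commutator domain.
\<close>

section \<open>Complex inner products and closed subspaces\<close>

lemma cinner_scaleC_left: "cinner (c *\<^sub>C x) y = cnj c * cinner x y"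
  for x :: "'h::complex_hilbert_space"
  by (metis cinner_scaleC_right cinner_commute complex_cnj_mult)

lemma inner_left_eqI:
  fixes x y :: "'a::real_inner"
  assumes "\<And>z. inner x z = inner y z"
  shows "x = y"
proof -
  have "inner (x - y) (x - y) = 0" by (simp add: inner_diff_left assms)
  then show ?thesis by simp
qed

text \<open>The real inner product determines the complex one: the real part of
  \<open>cinner x y\<close> is \<open>inner x y\<close>, and its imaginary part is
  \<open>inner (\<i> *\<^sub>C x) y\<close>.\<close>

lemma cinner_eq_if_inner_eq:
  fixes x y :: "'h::complex_hilbert_space"
  assumes "inner x y = inner z w" "inner (\<i> *\<^sub>C x) y = inner (\<i> *\<^sub>C z) w"
  shows "cinner x y = cinner z w"
  using assms by (simp add: complex_eq_iff cinner_scaleC_left flip: Re_cinner)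

lemma norm_scaleC: "norm (c *\<^sub>C x) = cmod c * norm x" for x :: "'h::complex_hilbert_space"
proof -
  have "(norm (c *\<^sub>C x))\<^sup>2 = Re ((cnj c * c) * cinner x x)"
    by (simp add: power2_norm_eq_inner cinner_scaleC_left cinner_scaleC_right ac_simps flip: Re_cinner)
  also have "cnj c * c = complex_of_real ((cmod c)\<^sup>2)"
    by (metis complex_norm_square mult.commute of_real_power)
  also have "Re (\<dots> * cinner x x) = (cmod c * norm x)\<^sup>2"
    by (simp add: Re_cinner power_mult_distrib power2_norm_eq_inner)
  finally show ?thesis by (simp add: power2_eq_iff_nonneg)
qed

lemma bounded_linear_scaleC: "bounded_linear (\<lambda>x :: 'h::complex_hilbert_space. c *\<^sub>C x)"
proof (rule bounded_linear_intro[where K = "cmod c"])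
  show "c *\<^sub>C r *\<^sub>R x = r *\<^sub>R c *\<^sub>C x" for r and x :: 'h
    by (simp add: scaleC_scaleC mult.commute flip: scaleC_of_real)
qed (simp_all add: scaleC_add_right norm_scaleC mult.commute)

lemma real_subspace_if_complex_subspace:
  "complex_vector.subspace S \<Longrightarrow> subspace (S :: 'h::complex_hilbert_space set)"
  unfolding complex_vector.subspace_def subspace_def by (metis scaleC_of_real)

lemma complex_subspace_closure:
  fixes S :: "'h::complex_hilbert_space set"
  assumes "complex_vector.subspace S"
  shows "complex_vector.subspace (closure S)"
proof (rule complex_vector.subspaceI)
  show "0 \<in> closure S"
    using assms closure_subset complex_vector.subspace_0 by blast
  show "x + y \<in> closure S" if xy: "x \<in> closure S" "y \<in> closure S" for x y
  proof -
    obtain f g where "\<And>n. f n \<in> S" "f \<longlonglongrightarrow> x" "\<And>n. g n \<in> S" "g \<longlonglongrightarrow> y"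
      using xy unfolding closure_sequential by blast
    then have "\<And>n. f n + g n \<in> S" "(\<lambda>n. f n + g n) \<longlonglongrightarrow> x + y"
      using assms complex_vector.subspace_add by (blast, intro tendsto_add)
    then show ?thesis unfolding closure_sequential by (intro exI[where x = "\<lambda>n. f n + g n"]) simp
  qed
  show "c *\<^sub>C x \<in> closure S" if x: "x \<in> closure S" for c x
  proof -
    obtain f where "\<And>n. f n \<in> S" "f \<longlonglongrightarrow> x"
      using x unfolding closure_sequential by blast
    then have "\<And>n. c *\<^sub>C f n \<in> S" "(\<lambda>n. c *\<^sub>C f n) \<longlonglongrightarrow> c *\<^sub>C x"
      using assms complex_vector.subspace_scale
      by (blast, intro bounded_linear.tendsto[OF bounded_linear_scaleC])
    then show ?thesis unfolding closure_sequential by (intro exI[where x = "\<lambda>n. c *\<^sub>C f n"]) simp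
  qed
qed

section \<open>The projection theorem\<close>

text \<open>The foot \<open>y\<close> is the point of \<open>S\<close> nearest to \<open>x\<close>.
  A minimising sequence is Cauchy by the parallelogram law, completeness and closedness give a
  minimiser in \<open>S\<close>, and minimality along each line through it forces
  orthogonality.\<close>

lemma ex_orthogonal_projection:
  fixes S :: "'a::{real_inner, complete_space} set"
  assumes "closed S" "subspace S"
  shows "\<exists>y\<in>S. \<forall>s\<in>S. inner (x - y) s = 0"
proof -
  define d where "d = Inf ((\<lambda>y. (norm (x - y))\<^sup>2) ` S)"
  have ne: "S \<noteq> {}" using assms(2) subspace_0 by blast
  have bdd: "bdd_below ((\<lambda>y. (norm (x - y))\<^sup>2) ` S)" by (rule bdd_belowI[of _ 0]) auto
  have d_le: "d \<le> (norm (x - y))\<^sup>2" if "y \<in> S" for y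
    unfolding d_def using that by (intro cInf_lower[OF _ bdd]) auto
  have "\<exists>y\<in>S. (norm (x - y))\<^sup>2 < d + 1 / Suc n" for n
    using cInf_lessD[of "(\<lambda>y. (norm (x - y))\<^sup>2) ` S" "d + 1 / Suc n"] ne unfolding d_def by auto
  then obtain y where yS: "\<And>n. y n \<in> S" and y: "\<And>n. (norm (x - y n))\<^sup>2 < d + 1 / Suc n"
    by metis
  \<comment> \<open>The midpoint of \<open>y m\<close> and \<open>y n\<close> lies in
    \<open>S\<close>, so its squared distance from \<open>x\<close> is at least \<open>d\<close>.
    The parallelogram law then bounds the distance of the two points by their excess over
    \<open>d\<close>.\<close>
  have close: "(norm (y m - y n))\<^sup>2 \<le> 4 / Suc k" if "m \<ge> k" "n \<ge> k" for m n k
  proof -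
    have "(1/2) *\<^sub>R (y m + y n) \<in> S" using assms(2) yS by (simp add: subspace_add subspace_scale)
    note mid = d_le[OF this]
    have "(x - y m) + (x - y n) = 2 *\<^sub>R (x - (1/2) *\<^sub>R (y m + y n))"
      by (simp add: algebra_simps scaleR_2)
    then have "(norm ((x - y m) + (x - y n)))\<^sup>2 = 4 * (norm (x - (1/2) *\<^sub>R (y m + y n)))\<^sup>2"
      by (simp add: power_mult_distrib)
    then have "4 * d \<le> (norm ((x - y m) + (x - y n)))\<^sup>2" using mid by simp
    moreover have "(norm ((x - y m) + (x - y n)))\<^sup>2 + (norm (y m - y n))\<^sup>2
        = 2 * (norm (x - y m))\<^sup>2 + 2 * (norm (x - y n))\<^sup>2"
      by (simp add: power2_norm_eq_inner inner_diff_left inner_diff_right inner_add_left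
          inner_add_right inner_commute)
    moreover have "1 / real (Suc m) \<le> 1 / Suc k" "1 / real (Suc n) \<le> 1 / Suc k"
      using that by (auto intro!: divide_left_mono)
    ultimately show ?thesis using y[of m] y[of n] by linarith
  qed
  have "Cauchy y"
  proof (rule metric_CauchyI)
    fix e :: real assume "e > 0"
    then obtain k where k: "1 / real (Suc k) < e\<^sup>2 / 4"
      using nat_approx_posE[of "e\<^sup>2 / 4"] by (metis zero_less_divide_iff zero_less_numeral zero_less_power)
    show "\<exists>M. \<forall>m\<ge>M. \<forall>n\<ge>M. dist (y m) (y n) < e"
    proof (intro exI allI impI)
      fix m n assume "m \<ge> k" "n \<ge> k"
      from close[OF this] k have "(norm (y m - y n))\<^sup>2 < e\<^sup>2" by simp
      then show "dist (y m) (y n) < e"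
        unfolding dist_norm by (rule power2_less_imp_less) (use \<open>e > 0\<close> in simp)
    qed
  qed
  then obtain z where z: "y \<longlonglongrightarrow> z" using Cauchy_convergent convergentD by blast
  have zS: "z \<in> S" using closed_sequentially[OF assms(1)] yS z by blast
  have "(\<lambda>n. (norm (x - y n))\<^sup>2) \<longlonglongrightarrow> (norm (x - z))\<^sup>2" by (intro tendsto_intros z)
  moreover have "(\<lambda>n. d + 1 / Suc n) \<longlonglongrightarrow> d + 0"
    by (intro tendsto_intros LIMSEQ_Suc[OF lim_1_over_n])
  ultimately have zd: "(norm (x - z))\<^sup>2 \<le> d"
    using y by (intro LIMSEQ_le[of "\<lambda>n. (norm (x - y n))\<^sup>2" _ "\<lambda>n. d + 1 / Suc n"])
      (auto intro: less_imp_le simp del: of_nat_Suc)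
  have "inner (x - z) s = 0" if s: "s \<in> S" for s
  proof (cases "s = 0")
    case False
    define k where "k = inner (x - z) s"
    \<comment> \<open>The minimiser of the squared distance from \<open>x\<close> along the line
      \<open>z + t *\<^sub>R s\<close>. There the squared distance drops by \<open>t * k\<close>,
      which is the square of \<open>k\<close> divided by \<open>inner s s\<close>; as
      \<open>z\<close> is already nearest, \<open>k\<close> vanishes.\<close>
    define t where "t = k / inner s s"
    have ss: "inner s s > 0" using False by simp
    have expand: "(norm (w - t *\<^sub>R s))\<^sup>2 = (norm w)\<^sup>2 - 2 * t * inner w s + t * (t * inner s s)" for w
      unfolding power2_norm_eq_inner inner_diff_left inner_diff_right inner_scaleR_left
        inner_scaleR_right using inner_commute[of s w] by (simp add: algebra_simps)
    have "z + t *\<^sub>R s \<in> S" using assms(2) zS s by (simp add: subspace_add subspace_scale)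
    from order_trans[OF zd d_le[OF this]] have "(norm (x - z))\<^sup>2 \<le> (norm (x - z - t *\<^sub>R s))\<^sup>2"
      by (simp only: diff_diff_eq)
    moreover have tk: "t * inner s s = k" unfolding t_def using ss by simp
    ultimately have "t * k \<le> 0" unfolding expand k_def[symmetric] tk by (simp add: mult.commute)
    then have "k * k \<le> 0" unfolding t_def using ss by (simp add: divide_le_0_iff)
    then show ?thesis unfolding k_def by (auto simp: mult_le_0_iff)
  qed simp
  then show ?thesis using zS by blast
qed

section \<open>Elementary properties of projections and their ranges\<close>

lemma projection_linear:
  "P \<in> projections \<Longrightarrow> linear (P :: 'h::complex_hilbert_space \<Rightarrow> 'h)"
  by (simp add: projections_def bounded_linear.linear)

lemma projection_scaleC: "P \<in> projections \<Longrightarrow> P (c *\<^sub>C x) = c *\<^sub>C P x"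
  by (simp add: projections_def)

lemma projection_idem: "P \<in> projections \<Longrightarrow> P (P x) = P x"
  by (simp add: projections_def fun_eq_iff)

lemma projection_adjoint: "P \<in> projections \<Longrightarrow> inner (P x) y = inner x (P y)"
  by (metis (mono_tags, lifting) Re_cinner mem_Collect_eq projections_def)

lemma projection_continuous:
  "P \<in> projections \<Longrightarrow> continuous_on A (P :: 'h::complex_hilbert_space \<Rightarrow> 'h)"
  by (simp add: projections_def linear_continuous_on)

lemma projection_range_iff: "P \<in> projections \<Longrightarrow> x \<in> range P \<longleftrightarrow> P x = x"
  by (metis projection_idem rangeE rangeI)

lemma projection_range_closed:
  fixes P :: "'h::complex_hilbert_space \<Rightarrow> 'h"
  assumes "P \<in> projections"
  shows "closed (range P)"
proof -
  have "range P = {x. P x = x}" using projection_range_iff[OF assms] by blast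
  also have "closed \<dots>" by (intro closed_Collect_eq projection_continuous assms continuous_on_id)
  finally show ?thesis .
qed

lemma projection_range_subspace:
  fixes P :: "'h::complex_hilbert_space \<Rightarrow> 'h"
  assumes "P \<in> projections"
  shows "complex_vector.subspace (range P)"
proof (rule complex_vector.subspaceI)
  note lin = projection_linear[OF assms]
  show "0 \<in> range P" using linear_0[OF lin] by (metis rangeI)
  show "x + y \<in> range P" if "x \<in> range P" "y \<in> range P" for x y
    using that linear_add[OF lin, symmetric] by auto
  show "c *\<^sub>C x \<in> range P" if "x \<in> range P" for c x
    using that projection_scaleC[OF assms, symmetric] by auto
qed

text \<open>The second equation is the adjoint of the first.\<close>

lemma projection_le_iff:
  fixes P Q :: "'h::complex_hilbert_space \<Rightarrow> 'h"
  assumes "P \<in> projections" "Q \<in> projections" "range P \<subseteq> range Q"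
  shows "Q (P x) = P x" "P (Q x) = P x"
proof -
  show QP: "Q (P x) = P x" for x using assms projection_range_iff by blast
  have "inner (P (Q x)) y = inner (P x) y" for y
    by (simp add: projection_adjoint[OF assms(1)] projection_adjoint[OF assms(2)] QP)
  then show "P (Q x) = P x" by (rule inner_left_eqI)
qed

lemma projection_eqI:
  fixes P Q :: "'h::complex_hilbert_space \<Rightarrow> 'h"
  assumes "P \<in> projections" "Q \<in> projections" "range P = range Q"
  shows "P = Q"
  using projection_le_iff[of P Q] projection_le_iff[of Q P] assms by (intro ext) (metis order_refl)

text \<open>Since \<open>P\<close> commutes with multiplication by \<i>, self-adjointness for the
  real inner product carries over to the complex one.\<close>

lemma projection_if_adjoint:
  fixes P :: "'h::complex_hilbert_space \<Rightarrow> 'h"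
  assumes "bounded_linear P" and C: "\<And>c x. P (c *\<^sub>C x) = c *\<^sub>C P x" and "\<And>x. P (P x) = P x"
    and "\<And>x y. inner (P x) y = inner x (P y)"
  shows "P \<in> projections"
proof -
  have "cinner (P x) y = cinner x (P y)" for x y
    by (rule cinner_eq_if_inner_eq) (simp_all add: assms(4) flip: C)
  then show ?thesis using assms by (simp add: projections_def fun_eq_iff)
qed

lemma ex_projection:
  fixes S :: "'h::complex_hilbert_space set"
  assumes "closed S" and sub: "complex_vector.subspace S"
  shows "\<exists>P\<in>projections. range P = S"
proof -
  note rsub = real_subspace_if_complex_subspace[OF sub]
  obtain P where PS: "\<And>x. P x \<in> S" and P: "\<And>x s. s \<in> S \<Longrightarrow> inner (x - P x) s = 0"
    using ex_orthogonal_projection[OF assms(1) rsub] by metis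
  \<comment> \<open>Membership in \<open>S\<close> together with an orthogonal residual determines
    \<open>P x\<close>. The action on \<open>S\<close>, additivity and complex homogeneity are all
    obtained through this criterion.\<close>
  have uniq: "P x = y" if "y \<in> S" "\<And>s. s \<in> S \<Longrightarrow> inner (x - y) s = 0" for x y
  proof -
    have "P x - y \<in> S" using PS that(1) rsub subspace_diff by blast
    then have "inner (P x - y) (P x - y) = 0"
      using P[of "P x - y" x] that(2)[of "P x - y"] by (simp add: inner_diff_left)
    then show ?thesis by simp
  qed
  have fix_S: "P s = s" if "s \<in> S" for s by (rule uniq) (use that in auto)
  have Padd: "P (x + y) = P x + P y" for x y
  proof (rule uniq)
    show "inner (x + y - (P x + P y)) s = 0" if "s \<in> S" for s
      using P[OF that, of x] P[OF that, of y] by (simp add: inner_diff_left inner_add_left)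
  qed (use PS rsub subspace_add in blast)
  have PC: "P (c *\<^sub>C x) = c *\<^sub>C P x" for c x
  proof (rule uniq)
    show "c *\<^sub>C P x \<in> S" using PS sub complex_vector.subspace_scale by blast
    show "inner (c *\<^sub>C x - c *\<^sub>C P x) s = 0" if "s \<in> S" for s
    proof -
      have "c *\<^sub>C x - c *\<^sub>C P x = c *\<^sub>C (x - P x)"
        by (simp add: complex_vector.scale_right_diff_distrib)
      \<comment> \<open>The scalar moves to the other argument as its conjugate, where the complex
        subspace \<open>S\<close> absorbs it.\<close>
      moreover have "inner (c *\<^sub>C (x - P x)) s = inner (x - P x) (cnj c *\<^sub>C s)"
        by (simp add: cinner_scaleC_left cinner_scaleC_right flip: Re_cinner)
      moreover have "cnj c *\<^sub>C s \<in> S" using that sub complex_vector.subspace_scale by blast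
      ultimately show ?thesis using P by simp
    qed
  qed
  have Pnorm: "norm (P x) \<le> norm x" for x
  proof -
    have "(norm (P x))\<^sup>2 = inner x (P x)"
      using P[OF PS, of x x] by (simp add: inner_diff_left power2_norm_eq_inner)
    also have "\<dots> \<le> norm x * norm (P x)" by (rule norm_cauchy_schwarz)
    finally show ?thesis by (cases "P x = 0") (auto simp: power2_eq_square)
  qed
  have "bounded_linear P"
  proof (rule bounded_linear_intro[where K = 1])
    show "P (r *\<^sub>R x) = r *\<^sub>R P x" for r x by (simp add: PC flip: scaleC_of_real)
  qed (simp_all add: Padd Pnorm)
  moreover have "inner (P x) y = inner x (P y)" for x y
    using P[OF PS, of x y] P[OF PS, of y x] unfolding inner_diff_left
    by (metis inner_commute right_minus_eq)
  ultimately have "P \<in> projections" by (intro projection_if_adjoint PC) (auto simp: fix_S PS)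
  moreover have "range P = S" using PS fix_S by (metis image_subsetI subsetI subset_antisym rangeI)
  ultimately show ?thesis by blast
qed

text \<open>Existence and uniqueness justify the definite description, so meets and joins can from
  here on be handled through their ranges.\<close>

lemma proj_onto:
  fixes S :: "'h::complex_hilbert_space set"
  assumes "closed S" "complex_vector.subspace S"
  shows "proj_onto S \<in> projections" "range (proj_onto S) = S"
proof -
  have "\<exists>!P. P \<in> projections \<and> range P = S"
    using ex_projection[OF assms] projection_eqI by blast
  from theI'[OF this] show "proj_onto S \<in> projections" "range (proj_onto S) = S"
    unfolding proj_onto_def by auto
qed

lemma proj_onto_range: "P \<in> projections \<Longrightarrow> proj_onto (range P) = P"
  by (intro projection_eqI proj_onto projection_range_closed projection_range_subspace)

section \<open>The lattice of projections\<close>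

lemma id_projection: "id \<in> projections"
  and zero_projection: "(\<lambda>_. 0) \<in> projections"
  by (rule projection_if_adjoint; simp add: bounded_linear_ident[folded id_def])+

lemma zero_in_range: "P \<in> projections \<Longrightarrow> 0 \<in> range P"
  using projection_range_subspace complex_vector.subspace_0 by blast

lemma projection_eq_id: "P \<in> projections \<Longrightarrow> range P = UNIV \<Longrightarrow> P = id"
  by (rule projection_eqI) (auto simp: id_projection)

section \<open>Meets, joins and the Sasaki implication\<close>

lemma Meet_projection:
  assumes "A \<subseteq> projections"
  shows "Meet A \<in> projections" and range_Meet: "range (Meet A) = (\<Inter>P\<in>A. range P)"
proof -
  have "closed (\<Inter>P\<in>A. range P)"
    by (rule closed_INT) (auto intro!: projection_range_closed subsetD[OF assms])
  moreover have "complex_vector.subspace (\<Inter>P\<in>A. range P)"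
    by (rule complex_vector.subspace_Inter)
      (auto intro!: projection_range_subspace subsetD[OF assms])
  ultimately show "Meet A \<in> projections" "range (Meet A) = (\<Inter>P\<in>A. range P)"
    unfolding Meet_def by (auto simp: proj_onto)
qed

lemma Join_projection: "Join A \<in> projections"
  and range_Join: "range (Join A) = closure (complex_vector.span (\<Union>P\<in>A. range P))"
  unfolding Join_def by (simp_all add: proj_onto complex_subspace_closure)

lemma Join_upper: "P \<in> A \<Longrightarrow> range P \<subseteq> range (Join A)"
  unfolding range_Join
  by (rule order_trans[OF _ order_trans[OF complex_vector.span_superset closure_subset]]) blast

lemma Join_least:
  assumes "closed S" "complex_vector.subspace S" "\<And>P. P \<in> A \<Longrightarrow> range P \<subseteq> S"
  shows "range (Join A) \<subseteq> S"
  unfolding range_Join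
  by (intro closure_minimal complex_vector.span_minimal UN_least assms)

text \<open>When the family has a greatest member, its range is already closed and a subspace, so
  the closed span adds nothing.\<close>

lemma Join_eqI:
  assumes "P \<in> A" "P \<in> projections" "\<And>Q. Q \<in> A \<Longrightarrow> range Q \<subseteq> range P"
  shows "Join A = P"
  using assms Join_upper[of P A] Join_least[of "range P" A]
  by (intro projection_eqI Join_projection subset_antisym)
    (auto simp: projection_range_closed projection_range_subspace)

lemma Meet_eqI:
  assumes "P \<in> A" "P \<in> projections" "\<And>Q. Q \<in> A \<Longrightarrow> range P \<subseteq> range Q"
  shows "Meet A = P"
proof -
  have "(\<Inter>Q\<in>A. range Q) = range P" using assms by blast
  then show ?thesis unfolding Meet_def by (simp add: proj_onto_range assms)
qed

lemma meet_projection: "P \<in> projections \<Longrightarrow> Q \<in> projections \<Longrightarrow> P \<^bold>\<and> Q \<in> projections"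
  unfolding meet_def by (rule Meet_projection) auto

lemma range_meet:
  "P \<in> projections \<Longrightarrow> Q \<in> projections \<Longrightarrow> range (P \<^bold>\<and> Q) = range P \<inter> range Q"
  unfolding meet_def by (subst range_Meet) auto

lemma imp_projection: "(P \<^bold>\<Rightarrow> Q) \<in> projections"
  unfolding sasaki_imp_def join_def by (rule Join_projection)

lemma iff_projection: "(P \<^bold>\<Leftrightarrow> Q) \<in> projections"
  unfolding sasaki_iff_def by (intro meet_projection imp_projection)

lemma ball_val_projection: "ball_val u \<phi> \<in> projections"
  unfolding ball_val_def by (rule Meet_projection) (auto simp: imp_projection)

lemma bex_val_projection: "bex_val u \<phi> \<in> projections"
  unfolding bex_val_def by (rule Join_projection)

lemma meet_eq_id:
  assumes "P \<in> projections" "Q \<in> projections" "P \<^bold>\<and> Q = id"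
  shows "P = id" "Q = id"
  using range_meet[OF assms(1,2)] assms projection_eq_id by auto

lemma meet_id_left: "P \<in> projections \<Longrightarrow> id \<^bold>\<and> P = P"
  and meet_id_right: "P \<in> projections \<Longrightarrow> P \<^bold>\<and> id = P"
  and meet_zero_right: "P \<in> projections \<Longrightarrow> P \<^bold>\<and> (\<lambda>_. 0) = (\<lambda>_. 0)"
  unfolding meet_def using zero_in_range[of P]
  by (auto intro!: Meet_eqI simp: zero_projection)

text \<open>Check names carry the label \<open>id\<close>, so this removes the guard from bounded
  universal quantifiers over them.\<close>

lemma id_imp:
  assumes "P \<in> projections"
  shows "(id \<^bold>\<Rightarrow> P) = P"
proof -
  have "perp id = (\<lambda>_::'a. 0)" by (simp add: perp_def)
  then show ?thesis unfolding sasaki_imp_def join_def meet_id_left[OF assms]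
    by (intro Join_eqI) (use assms in \<open>auto simp: zero_in_range\<close>)
qed

text \<open>\<open>P\<close> kills the range of \<open>perp P\<close> and fixes the range of the
  meet, so it maps both into \<open>?M\<close>. The preimage of \<open>?M\<close> under
  \<open>P\<close> is a closed subspace and hence contains the range of the whole implication; if
  that is everything, \<open>P\<close> takes all its values in \<open>?M\<close>.\<close>

lemma imp_eq_id_imp_le:
  fixes P Q :: "'h::complex_hilbert_space \<Rightarrow> 'h"
  assumes P: "P \<in> projections" and Q: "Q \<in> projections" and "(P \<^bold>\<Rightarrow> Q) = id"
  shows "range P \<subseteq> range Q"
proof -
  let ?M = "range P \<inter> range Q"
  note lin = projection_linear[OF P]
  have M: "closed ?M" "complex_vector.subspace ?M"
    using P Q by (simp_all add: closed_Int complex_vector.subspace_inter projection_range_closed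
        projection_range_subspace)
  have "range (P \<^bold>\<Rightarrow> Q) \<subseteq> P -` ?M"
    unfolding sasaki_imp_def join_def
  proof (rule Join_least)
    show "closed (P -` ?M)"
      using M(1) projection_continuous[OF P] by (rule closed_vimage)
    show "complex_vector.subspace (P -` ?M)"
      using M(2)[THEN complex_vector.subspace_0] M(2)[THEN complex_vector.subspace_add]
        M(2)[THEN complex_vector.subspace_scale]
      by (intro complex_vector.subspaceI)
        (simp_all only: vimage_eq linear_add[OF lin] linear_0[OF lin] projection_scaleC[OF P])
    show "range R \<subseteq> P -` ?M" if "R \<in> {perp P, P \<^bold>\<and> Q}" for R
    proof -
      have "P (perp P x) = 0" for x
        by (simp add: perp_def linear_diff[OF lin] projection_idem[OF P])
      moreover have "range (P \<^bold>\<and> Q) \<subseteq> P -` ?M"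
        unfolding range_meet[OF P Q] using projection_range_iff[OF P] by auto
      moreover have "0 \<in> ?M" using M(2) complex_vector.subspace_0 by blast
      ultimately show ?thesis using that by (elim insertE emptyE) auto
    qed
  qed
  then have "P x \<in> ?M" for x using assms(3) by auto
  then show ?thesis by blast
qed

section \<open>Commuting projections and the commutator domain\<close>

text \<open>Commutation makes the product idempotent and self-adjoint, and its range is the
  intersection of the two ranges. This turns the meets in the definition of \<open>cdom\<close> into
  products.\<close>

lemma projection_comp:
  fixes P E :: "'h::complex_hilbert_space \<Rightarrow> 'h"
  assumes P: "P \<in> projections" and E: "E \<in> projections" and comm: "E \<circ> P = P \<circ> E"
  shows "P \<^bold>\<and> E = P \<circ> E"
proof (rule projection_eqI)
  have c: "E (P x) = P (E x)" for x using comm by (metis comp_apply)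
  show PE: "P \<circ> E \<in> projections"
  proof (rule projection_if_adjoint)
    show "bounded_linear (P \<circ> E)"
      using P E bounded_linear_compose unfolding projections_def comp_def by blast
  qed (simp_all add: projection_scaleC projection_adjoint P E c projection_idem)
  show "range (P \<^bold>\<and> E) = range (P \<circ> E)"
    unfolding range_meet[OF P E] using c P E
    by (auto simp: image_iff) (metis projection_idem)+
qed (intro meet_projection P E)

text \<open>Invariance says \<open>E P E = P E\<close> as operators. The left side is self-adjoint,
  so taking adjoints yields \<open>E P E = E P\<close> too.\<close>

lemma commutes_if_invariant:
  fixes P E :: "'h::complex_hilbert_space \<Rightarrow> 'h"
  assumes P: "P \<in> projections" and E: "E \<in> projections"
    and inv: "\<And>x. x \<in> range E \<Longrightarrow> P x \<in> range E"
  shows "E \<circ> P = P \<circ> E"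
proof
  fix x
  have EPE: "E (P (E x)) = P (E x)" for x
    using inv[of "E x"] projection_range_iff[OF E] by blast
  have "inner (E (P x)) y = inner (P (E x)) y" for y
  proof -
    have "inner (E (P x)) y = inner x (E (P (E y)))"
      by (simp add: EPE projection_adjoint P E)
    also have "\<dots> = inner (E (P (E x))) y" by (simp add: projection_adjoint P E)
    finally show ?thesis by (simp only: EPE)
  qed
  then show "(E \<circ> P) x = (P \<circ> E) x" by (auto intro: inner_left_eqI)
qed

lemma commutator_kernel:
  fixes P Q :: "'h::complex_hilbert_space \<Rightarrow> 'h"
  assumes P: "P \<in> projections" and Q: "Q \<in> projections"
  shows "closed {\<psi>. commutator P Q \<psi> = 0}" "complex_vector.subspace {\<psi>. commutator P Q \<psi> = 0}"
proof -
  have PQ: "bounded_linear P" "bounded_linear Q" using P Q by (simp_all add: projections_def)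
  have "continuous_on UNIV (\<lambda>\<psi>. P (Q \<psi>) - Q (P \<psi>))"
    by (rule linear_continuous_on[OF bounded_linear_sub[OF
        bounded_linear_compose[OF PQ] bounded_linear_compose[OF PQ(2,1)]]])
  then show "closed {\<psi>. commutator P Q \<psi> = 0}" unfolding commutator_def
    by (rule closed_Collect_eq) (rule continuous_on_const)
  show "complex_vector.subspace {\<psi>. commutator P Q \<psi> = 0}"
    by (rule complex_vector.subspaceI)
      (simp_all add: commutator_def projection_linear P Q linear_0 linear_add projection_scaleC)
qed

lemma cdom_eq_proj_onto:
  fixes A :: "('h::complex_hilbert_space \<Rightarrow> 'h) set"
  defines "S \<equiv> {\<psi>. \<forall>P\<in>A. \<forall>Q\<in>A. commutator P Q \<psi> = 0}"
  assumes A: "A \<subseteq> projections" and inv: "\<And>P \<psi>. P \<in> A \<Longrightarrow> \<psi> \<in> S \<Longrightarrow> P \<psi> \<in> S"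
  shows "cdom A = proj_onto S"
proof -
  \<comment> \<open>As an intersection of commutator kernels, \<open>S\<close> is a closed complex
    subspace.\<close>
  have S: "S = \<Inter> ((\<lambda>(P, Q). {\<psi>. commutator P Q \<psi> = 0}) ` (A \<times> A))"
    unfolding S_def by auto
  have cl: "closed S"
    unfolding S by (rule closed_Inter) (auto intro!: commutator_kernel(1) subsetD[OF A])
  have sub: "complex_vector.subspace S"
    unfolding S by (rule complex_vector.subspace_Inter)
      (auto intro!: commutator_kernel(2) subsetD[OF A])
  define E where "E = proj_onto S"
  have E: "E \<in> projections" and rE: "range E = S"
    unfolding E_def by (simp_all add: proj_onto cl sub)
  have comm: "E \<circ> P = P \<circ> E" if "P \<in> A" for P
    by (rule commutes_if_invariant) (use that A E inv in \<open>auto simp: rE\<close>)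
  \<comment> \<open>Since \<open>F\<close> commutes with \<open>P\<close> and \<open>Q\<close>, the
    two sides are \<open>P Q F\<close> and \<open>Q P F\<close> as products of operators.\<close>
  have iff: "(P \<^bold>\<and> F) \<circ> (Q \<^bold>\<and> F) = (Q \<^bold>\<and> F) \<circ> (P \<^bold>\<and> F) \<longleftrightarrow> (\<forall>x. commutator P Q (F x) = 0)"
    if F: "F \<in> commutant A" and PQ: "P \<in> A" "Q \<in> A" for F P Q
  proof -
    have Fp: "F \<in> projections" and c: "F \<circ> P = P \<circ> F" "F \<circ> Q = Q \<circ> F"
      using F PQ by (auto simp: commutant_def)
    have c': "F (P x) = P (F x)" "F (Q x) = Q (F x)" for x using c by (metis comp_apply)+
    have m: "P \<^bold>\<and> F = P \<circ> F" "Q \<^bold>\<and> F = Q \<circ> F"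
      using projection_comp Fp c PQ A by blast+
    show ?thesis
      unfolding m fun_eq_iff by (simp add: c' projection_idem[OF Fp] commutator_def)
  qed
  show ?thesis
    unfolding cdom_def E_def[symmetric]
  proof (rule Join_eqI)
    show "E \<in> projections" by fact
    have "E \<in> commutant A" using E comm by (simp add: commutant_def)
    moreover have "E x \<in> S" for x using rE by blast
    ultimately show "E \<in> {E \<in> commutant A. \<forall>P\<^sub>1\<in>A. \<forall>P\<^sub>2\<in>A.
        (P\<^sub>1 \<^bold>\<and> E) \<circ> (P\<^sub>2 \<^bold>\<and> E) = (P\<^sub>2 \<^bold>\<and> E) \<circ> (P\<^sub>1 \<^bold>\<and> E)}"
      using iff by (auto simp: S_def)
    show "range F \<subseteq> range E" if "F \<in> {E \<in> commutant A. \<forall>P\<^sub>1\<in>A. \<forall>P\<^sub>2\<in>A.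
        (P\<^sub>1 \<^bold>\<and> E) \<circ> (P\<^sub>2 \<^bold>\<and> E) = (P\<^sub>2 \<^bold>\<and> E) \<circ> (P\<^sub>1 \<^bold>\<and> E)}" for F
      unfolding rE S_def using that iff by blast
  qed
qed

section \<open>Truth values of check names\<close>

text \<open>The copy of the two-element Boolean algebra inside the projection lattice, in which
  equality and membership of check names take their values.\<close>

definition truth :: "bool \<Rightarrow> ('h::complex_hilbert_space \<Rightarrow> 'h)" where
  "truth b = (if b then id else (\<lambda>_. 0))"

lemma truth_projection: "truth b \<in> projections"
  by (simp add: truth_def id_projection zero_projection)

lemma range_truth_mono: "(a \<Longrightarrow> b) \<Longrightarrow> range (truth a) \<subseteq> range (truth b)"
  by (auto simp: truth_def)

lemma Meet_truth:
  "Meet ((\<lambda>x. truth (b x)) ` A) = (truth (\<forall>x\<in>A. b x) :: 'h \<Rightarrow> 'h::complex_hilbert_space)"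
proof (cases "A = {}")
  case True
  then show ?thesis
    using proj_onto_range[OF id_projection] by (simp add: Meet_def truth_def)
next
  case False
  \<comment> \<open>A counterexample if there is one, otherwise any element: in both cases the least
    member of the family.\<close>
  then obtain x where x: "x \<in> A" "b x \<longleftrightarrow> (\<forall>x\<in>A. b x)" by blast
  show ?thesis
    unfolding x(2)[symmetric]
  proof (rule Meet_eqI)
    fix Q :: "'h \<Rightarrow> 'h" assume "Q \<in> (\<lambda>x. truth (b x)) ` A"
    then obtain y where "y \<in> A" "Q = truth (b y)" by blast
    then show "range (truth (b x)) \<subseteq> range Q" using x range_truth_mono[of "b x" "b y"] by blast
  qed (use x(1) in \<open>auto simp: truth_projection\<close>)
qed

lemma Join_truth:
  "Join ((\<lambda>x. truth (b x)) ` A) = (truth (\<exists>x\<in>A. b x) :: 'h \<Rightarrow> 'h::complex_hilbert_space)"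
proof (cases "A = {}")
  case True
  then have "range (Join ((\<lambda>x. truth (b x)) ` A)) = range (truth False :: 'h \<Rightarrow> 'h)"
    unfolding range_Join by (simp add: truth_def image_constant_conv)
  then have "Join ((\<lambda>x. truth (b x)) ` A) = (truth False :: 'h \<Rightarrow> 'h)"
    by (rule projection_eqI[OF Join_projection truth_projection])
  then show ?thesis using True by simp
next
  case False
  \<comment> \<open>Dually, a true instance if there is one gives the greatest member.\<close>
  then obtain x where x: "x \<in> A" "b x \<longleftrightarrow> (\<exists>x\<in>A. b x)" by blast
  show ?thesis
    unfolding x(2)[symmetric]
  proof (rule Join_eqI)
    fix Q :: "'h \<Rightarrow> 'h" assume "Q \<in> (\<lambda>x. truth (b x)) ` A"
    then obtain y where "y \<in> A" "Q = truth (b y)" by blast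
    then show "range Q \<subseteq> range (truth (b x))" using x range_truth_mono[of "b y" "b x"] by blast
  qed (use x(1) in \<open>auto simp: truth_projection\<close>)
qed

section \<open>Evaluation of check names\<close>

lemma dom_check: "dom_name (check v) = check ` dom_name v"
  by (simp add: dom_name_def[of "check v"] graph_check image_image)

lemma val_eqI: "(x, p) \<in> graph u \<Longrightarrow> (\<And>p'. (x, p') \<in> graph u \<Longrightarrow> p' = p) \<Longrightarrow> val u x = p"
  unfolding val_def by blast

lemma val_check: "w \<in> dom_name v \<Longrightarrow> val (check v) (check w) = id"
  by (rule val_eqI) (auto simp: graph_check)

lemma dom_check_rats: "dom_name (check_rats q) = range (\<lambda>r. check (q r))"
  by (simp add: dom_name_def graph_check_rats image_image)

lemma val_check_rats: "val (check_rats q) (check (q r)) = id"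
  by (rule val_eqI) (auto simp: graph_check_rats)

lemma support_check: "support (check v) \<subseteq> {id}"
proof (induction v rule: name_induct)
  case (name v)
  have "val (check v) ` dom_name (check v) \<subseteq> {id}" by (auto simp: dom_check val_check)
  then show ?case
    using name by (subst support.simps) (auto simp only: dom_check)
qed

text \<open>Equality is taken as a hypothesis here so that the lemma can serve inside the induction
  that evaluates equality.\<close>

lemma mem_val_check_aux:
  fixes w y :: "'k pure_set"
  assumes "\<And>w'. w' \<in> dom_name y \<Longrightarrow>
    eq_val (check w) (check w' :: ('k, 'h::complex_hilbert_space \<Rightarrow> 'h) name) = truth (w = w')"
  shows "mem_val (check w) (check y :: ('k, 'h \<Rightarrow> 'h) name) = truth (w \<in> dom_name y)"
proof -
  have "mem_val (check w) (check y) = Join ((\<lambda>w'. truth (w = w') :: 'h \<Rightarrow> 'h) ` dom_name y)"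
    unfolding mem_val.simps[of "check w"] dom_check image_image
    by (intro arg_cong[where f = Join] image_cong)
      (simp_all add: val_check assms meet_id_left truth_projection)
  then show ?thesis by (simp add: Join_truth)
qed

text \<open>There is only one label of type \<open>unit\<close>, so the domain determines the graph;
  this is extensionality for pure sets.\<close>

lemma pure_set_eq_iff: "x = y \<longleftrightarrow> dom_name x = dom_name y" for x y :: "'k pure_set"
proof -
  have "graph z = dom_name z \<times> UNIV" for z :: "'k pure_set"
    unfolding dom_name_def by force
  then show ?thesis by (metis graph_inject)
qed

lemma eq_val_check:
  fixes x y :: "'k pure_set"
  shows "eq_val (check x) (check y :: ('k, 'h::complex_hilbert_space \<Rightarrow> 'h) name) = truth (x = y)"
proof -
  \<comment> \<open>Unfolding one equality leads to memberships in both directions, hence to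
    equalities with the smaller names in either order. Both orders are therefore proved
    together.\<close>
  have "(eq_val (check x) (check y) :: 'h \<Rightarrow> 'h) = truth (x = y) \<and>
    (eq_val (check y) (check x) :: 'h \<Rightarrow> 'h) = truth (y = x)"
  proof (induction x arbitrary: y rule: name_induct)
    case (name x)
    have mem: "(mem_val (check w) (check y) :: 'h \<Rightarrow> 'h) = truth (w \<in> dom_name y)"
      if "w \<in> dom_name x" for w y using name[OF that] by (intro mem_val_check_aux) simp
    have mem': "(mem_val (check w) (check x) :: 'h \<Rightarrow> 'h) = truth (w \<in> dom_name x)" for w
      using name by (intro mem_val_check_aux) simp
    have "Meet ((\<lambda>u'. val (check x) u' \<^bold>\<Rightarrow> mem_val u' (check y)) ` dom_name (check x)) =
        Meet ((\<lambda>w. truth (w \<in> dom_name y) :: 'h \<Rightarrow> 'h) ` dom_name x)"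
      unfolding dom_check image_image
      by (intro arg_cong[where f = Meet] image_cong)
        (simp_all add: val_check mem id_imp truth_projection)
    moreover have "Meet ((\<lambda>u'. val (check y) u' \<^bold>\<Rightarrow> mem_val u' (check x)) ` dom_name (check y)) =
        Meet ((\<lambda>w. truth (w \<in> dom_name x) :: 'h \<Rightarrow> 'h) ` dom_name y)"
      unfolding dom_check image_image
      by (intro arg_cong[where f = Meet] image_cong)
        (simp_all add: val_check mem' id_imp truth_projection)
    moreover have "truth a \<^bold>\<and> truth b = (truth (a \<and> b) :: 'h \<Rightarrow> 'h)" for a b
      by (cases a; cases b)
        (simp_all add: truth_def meet_id_right meet_zero_right id_projection zero_projection)
    moreover have "x = y \<longleftrightarrow> (\<forall>w\<in>dom_name x. w \<in> dom_name y) \<and> (\<forall>w\<in>dom_name y. w \<in> dom_name x)"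
      "y = x \<longleftrightarrow> (\<forall>w\<in>dom_name y. w \<in> dom_name x) \<and> (\<forall>w\<in>dom_name x. w \<in> dom_name y)"
      unfolding pure_set_eq_iff by blast+
    ultimately show ?case
      unfolding eq_val.simps[of "check x"] eq_val.simps[of "check y"] by (simp add: Meet_truth)
  qed
  then show ?thesis ..
qed

section \<open>Quantum reals\<close>

lemma less_val_check:
  assumes "r < s"
  shows "less_val q (check (q r)) (check (q s)) = (id :: 'h::complex_hilbert_space \<Rightarrow> 'h)"
  unfolding less_val_def eq_val_check
proof (rule Join_eqI)
  have "truth (q r = q r) \<^bold>\<and> truth (q s = q s) = (id :: 'h \<Rightarrow> 'h)"
    by (simp add: truth_def meet_id_left id_projection)
  \<comment> \<open>The pair of \<open>r\<close> and \<open>s\<close> itself contributes the top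
    element to the join.\<close>
  then show "(id :: 'h \<Rightarrow> 'h) \<in> {truth (q r = q r') \<^bold>\<and> truth (q s = q s') | r' s'. r' < s'}"
    using assms by (intro CollectI exI[of _ r] exI[of _ s] conjI) (rule sym)
qed (auto simp: id_projection)

text \<open>A meet has full range only if every member has.\<close>

lemma ball_val_eq_id:
  assumes "ball_val u \<phi> = id" "x \<in> dom_name u"
  shows "(val u x \<^bold>\<Rightarrow> \<phi> x) = id"
proof -
  have sub: "(\<lambda>x. val u x \<^bold>\<Rightarrow> \<phi> x) ` dom_name u \<subseteq> projections"
    using imp_projection by blast
  have "range (Meet ((\<lambda>x. val u x \<^bold>\<Rightarrow> \<phi> x) ` dom_name u)) = UNIV"
    using assms(1) by (simp add: ball_val_def)
  then show ?thesis
    unfolding range_Meet[OF sub] using assms(2) by (intro projection_eq_id imp_projection) blast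
qed

context
  fixes \<Q> :: "('h::complex_hilbert_space \<Rightarrow> 'h) set"
    and q :: "rat \<Rightarrow> 'k::infinite pure_set"
    and u :: "('k, 'h \<Rightarrow> 'h) name"
  assumes Q: "\<Q> \<subseteq> projections" and q: "inj q" and u: "u \<in> reals q \<Q>"
begin

lemma real_dom: "dom_name u = range (\<lambda>r. check (q r))"
  using u by (simp add: reals_def)

lemma real_projection: "val u (check (q r)) \<in> projections"
proof -
  have "u \<in> universe \<Q>" using u by (simp add: reals_def)
  then have "val u ` dom_name u \<subseteq> \<Q>" by cases
  then show ?thesis using Q real_dom by blast
qed

text \<open>By injectivity of \<open>q\<close>, every term of the join except the one with
  \<open>s = r\<close> is zero.\<close>

lemma mem_val_real: "mem_val (check (q r)) u = val u (check (q r))"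
  unfolding mem_val.simps[of _ u] real_dom image_image eq_val_check
proof (rule Join_eqI)
  show "val u (check (q r)) \<in> range (\<lambda>s. val u (check (q s)) \<^bold>\<and> truth (q r = q s))"
    by (rule image_eqI[where x = r]) (simp_all add: truth_def meet_id_right real_projection)
  show "range P \<subseteq> range (val u (check (q r)))"
    if "P \<in> range (\<lambda>s. val u (check (q s)) \<^bold>\<and> truth (q r = q s))" for P
    using that inj_eq[OF q]
    by (auto simp: truth_def meet_id_right meet_zero_right real_projection
        zero_in_range[OF real_projection] split: if_splits)
qed (rule real_projection)

text \<open>Uses the forward half of the cut condition in \<open>real_val\<close>, with
  \<open>y\<close> and \<open>z\<close> instantiated to the check names of \<open>r\<close> and
  \<open>s\<close>; the guards then evaluate to \<open>id\<close>.\<close>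

lemma real_mono:
  assumes "r \<le> s"
  shows "range (val u (check (q r))) \<subseteq> range (val u (check (q s)))"
proof (cases "r = s")
  case False
  then have "r < s" using assms by simp
  define B where "B y = ball_val (check_rats q) (\<lambda>z. less_val q y z \<^bold>\<Rightarrow> mem_val z u)" for y
  have rv: "real_val q u = id" using u by (simp add: reals_def)
  have "ball_val (check_rats q) (\<lambda>y. mem_val y u \<^bold>\<Leftrightarrow> B y) = id"
    unfolding B_def
    \<comment> \<open>The four conjuncts of \<open>real_val\<close> are nested to the right, so
      passing to the second component three times reaches the last one.\<close>
    by (rule meet_eq_id(2)[OF _ _ meet_eq_id(2)[OF _ _ meet_eq_id(2)[OF _ _ rv[unfolded real_val_def]]]];
        intro meet_projection ball_val_projection bex_val_projection)
  from ball_val_eq_id[OF this, of "check (q r)"] have "(mem_val (check (q r)) u \<^bold>\<Leftrightarrow> B (check (q r))) = id"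
    by (simp add: dom_check_rats val_check_rats id_imp iff_projection)
  then have "(mem_val (check (q r)) u \<^bold>\<Rightarrow> B (check (q r))) = id"
    unfolding sasaki_iff_def by (rule meet_eq_id(1)[OF imp_projection imp_projection])
  then have "range (val u (check (q r))) \<subseteq> range (B (check (q r)))"
    unfolding mem_val_real B_def by (intro imp_eq_id_imp_le real_projection ball_val_projection)
  \<comment> \<open>The meet lies below its member at \<open>s\<close>; the outer \<open>id\<close>
    is the label of that element in \<open>check_rats q\<close>.\<close>
  also have "\<dots> \<subseteq> range (id \<^bold>\<Rightarrow> (less_val q (check (q r)) (check (q s)) \<^bold>\<Rightarrow> mem_val (check (q s)) u))"
    unfolding B_def ball_val_def
    by (subst range_Meet) (auto simp: imp_projection dom_check_rats val_check_rats)
  also have "\<dots> = range (val u (check (q s)))"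
    using \<open>r < s\<close> by (simp add: less_val_check id_imp mem_val_real real_projection)
  finally show ?thesis .
qed simp

text \<open>Monotonicity makes the values of \<open>u\<close> a chain, and the product of two
  comparable projections is the smaller one.\<close>

lemma real_comp:
  "val u (check (q r)) (val u (check (q s)) x) = val u (check (q (min r s))) x"
proof (cases "r \<le> s")
  case True
  then show ?thesis
    using projection_le_iff(2)[OF real_projection real_projection real_mono] by simp
next
  case False
  then show ?thesis
    using projection_le_iff(1)[OF real_projection real_projection real_mono, of s r] by simp
qed

text \<open>The elements of the domain are check names, which add at most \<open>id\<close> to the
  support.\<close>

lemma real_support:
  "range (\<lambda>r. val u (check (q r))) \<subseteq> support u"
  "support u \<subseteq> insert id (range (\<lambda>r. val u (check (q r))))"
proof -
  have "support u = (\<Union>r. support (check (q r))) \<union> range (\<lambda>r. val u (check (q r)))"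
    by (simp add: support.simps[of u] real_dom image_image)
  moreover have "support (check (q r)) \<subseteq> {id}" for r by (rule support_check)
  ultimately show "range (\<lambda>r. val u (check (q r))) \<subseteq> support u"
    "support u \<subseteq> insert id (range (\<lambda>r. val u (check (q r))))" by blast+
qed

end

theorem theorem5p4:
  fixes \<Q> :: "('h::complex_hilbert_space \<Rightarrow> 'h) set"
    and q :: "rat \<Rightarrow> 'k::infinite pure_set"
    and u v :: "('k, 'h \<Rightarrow> 'h) name"
  assumes "is_logic \<Q>"
    and "inj q"
    and "u \<in> reals q \<Q>" and "v \<in> reals q \<Q>"
  shows "Or u v =
    proj_onto {\<psi>. \<forall>x y :: rat. commutator (val u (check (q x))) (val v (check (q y))) \<psi> = 0}"
proof -
  have Q: "\<Q> \<subseteq> projections" using assms(1) by (simp add: is_logic_def)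
  define A where "A = support u \<union> support v"
  define U where "U x = val u (check (q x))" for x
  define V where "V x = val v (check (q x))" for x
  have UP: "U x \<in> projections" and VP: "V x \<in> projections" for x
    unfolding U_def V_def by (rule real_projection[OF Q assms(2)] assms)+
  have UU: "U x (U y \<psi>) = U (min x y) \<psi>" and VV: "V x (V y \<psi>) = V (min x y) \<psi>" for x y \<psi>
    unfolding U_def V_def by (rule real_comp[OF Q assms(2)] assms)+
  have A: "range U \<subseteq> A" "range V \<subseteq> A" "A \<subseteq> insert id (range U \<union> range V)"
    using real_support[OF Q assms(2,3)] real_support[OF Q assms(2,4)]
    unfolding A_def U_def V_def by blast+
  define S where "S = {\<psi>. \<forall>P\<in>A. \<forall>Q\<in>A. commutator P Q \<psi> = 0}"
  \<comment> \<open>Only mixed pairs impose a condition: two values of the same real commute by the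
    symmetry of \<open>min\<close>, and \<open>id\<close> commutes with everything.\<close>
  have S: "\<psi> \<in> S \<longleftrightarrow> (\<forall>x y. U x (V y \<psi>) = V y (U x \<psi>))" for \<psi>
  proof
    assume "\<psi> \<in> S"
    then have "commutator (U x) (V y) \<psi> = 0" for x y using A unfolding S_def by blast
    then show "\<forall>x y. U x (V y \<psi>) = V y (U x \<psi>)" by (simp add: commutator_def)
  next
    assume *: "\<forall>x y. U x (V y \<psi>) = V y (U x \<psi>)"
    have "commutator P Q \<psi> = 0" if "P \<in> A" "Q \<in> A" for P Q
    proof -
      have "P \<in> insert id (range U \<union> range V)" "Q \<in> insert id (range U \<union> range V)"
        using that A(3) by blast+
      then show ?thesis by (auto simp: commutator_def * UU VV min.commute)
    qed
    then show "\<psi> \<in> S" by (simp add: S_def)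
  qed
  have "cdom A = proj_onto S"
    unfolding S_def
  proof (rule cdom_eq_proj_onto, fold S_def)
    show "A \<subseteq> projections" using A(3) UP VP id_projection by blast
    show "P \<psi> \<in> S" if "P \<in> A" "\<psi> \<in> S" for P \<psi>
    proof -
      have c: "U x (V y \<psi>) = V y (U x \<psi>)" for x y using that(2) S by blast
      \<comment> \<open>Since \<open>c\<close> is available at \<psi> only, each rewriting brings
        the factor from the other real next to \<psi>; the two factors from the same real then merge
        by \<open>UU\<close> or \<open>VV\<close>, and \<open>c\<close> applies again.\<close>
      have "U x \<psi> \<in> S" for x unfolding S by (simp add: UU flip: c)
      moreover have "V y \<psi> \<in> S" for y unfolding S by (simp add: VV c)
      ultimately show ?thesis using that A(3) by auto
    qed
  qed
  moreover have "S = {\<psi>. \<forall>x y. commutator (U x) (V y) \<psi> = 0}"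
    using S by (auto simp: commutator_def)
  ultimately show ?thesis by (simp add: Or_def A_def U_def V_def)
qed

end
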